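(* Suppose that $j_0\in J(k)$, where $k\in I$ and $j_0\in J$. If there exists some $i\in I$ with $i\neq k$ such that $j_0\in J(i)$ and $b_i^{p}-b_k^{p}<w\,(a_{ij_0}^{p}-a_{kj_0}^{p})$, then resetting $a_{kj_0}$ to zero is an equivalence operation.
   Context: Let $I=\{1,\dots,m\}$ and $J=\{1,\dots,n\}$ with $m,n\ge 1$. Let $A=(a_{ij})_{m\times n}$ be a matrix with entries in $[0,1]$ with $i$-th row $a_i$, and let $b=(b_i)_{m\times 1}$ be a vector with entries in $[0,1]$. Let $w\in(0,1)$ and $p>0$ be real numbers. For $x,y\in[0,1]$ put $\varphi(x,y)=\left(w x^{p}+(1-w)y^{p}\right)^{1/p}$ (weighted power mean). For $x\in[0,1]^n$ put $\varphi(a_i,x)=\max_{j\in J}\varphi(a_{ij},x_j)$, and let $S(A,b)=\{x\in[0,1]^n:\varphi(a_i,x)=b_i\ \forall i\in I\}$, the feasible set of the problem of minimizing $cx$ (for a given $c\in\mathbb{R}^n$) subject to $\varphi(a_i,x)=b_i$ ($i\in I$), $x\in[0,1]^n$. For $i\in I$ define $J^{-}(i)=\{j\in J: a_{ij}>b_i/\sqrt[p]{w}\}$, $J^{\infty}(i)=\{j\in J: b_i^{p}\ge 1-w,\ a_{ij}<[(b_i^{p}+w-1)/w]^{1/p}\}$ and $J(i)=J\setminus(J^{-}(i)\cup J^{\infty}(i))$. Changing the value of an entry $a_{ij}$ of $A$ is called an equivalence operation if it has no effect on the solutions of the problem, i.e. if $S(A',b)=S(A,b)$, where $A'$ is the matrix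 obtained from $A$ by this change. *)

theory Defs
  imports "HOL-Analysis.Analysis"
begin

text \<open>
  The index sets \<open>I\<close> and \<open>J\<close> are the finite types \<open>'m\<close> and \<open>'n\<close>; they are nonempty, as all types
  are. The \<open>p\<close>-th root of a nonnegative real is written with exponent \<open>1 / p\<close>; for \<open>p > 0\<close> the
  convention \<open>0 powr a = 0\<close> agrees with the usual powers and roots of \<open>0\<close>.
\<close>

definition wpm :: "real \<Rightarrow> real \<Rightarrow> real \<Rightarrow> real \<Rightarrow> real" where
  "wpm w p x y = (w * x powr p + (1 - w) * y powr p) powr (1 / p)"

definition row_comp :: "real \<Rightarrow> real \<Rightarrow> real ^ 'n \<Rightarrow> real ^ 'n \<Rightarrow> real" where
  "row_comp w p r x = (MAX j. wpm w p (r $ j) (x $ j))"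

definition feasible_set ::
    "real \<Rightarrow> real \<Rightarrow> real ^ 'n ^ 'm \<Rightarrow> real ^ 'm \<Rightarrow> (real ^ 'n) set" where
  "feasible_set w p A b =
     {x. (\<forall>j. x $ j \<in> {0..1}) \<and> (\<forall>i. row_comp w p (A $ i) x = b $ i)}"

definition J_minus :: "real \<Rightarrow> real \<Rightarrow> real ^ 'n ^ 'm \<Rightarrow> real ^ 'm \<Rightarrow> 'm \<Rightarrow> 'n set" where
  "J_minus w p A b i = {j. A $ i $ j > b $ i / w powr (1 / p)}"

definition J_inf :: "real \<Rightarrow> real \<Rightarrow> real ^ 'n ^ 'm \<Rightarrow> real ^ 'm \<Rightarrow> 'm \<Rightarrow> 'n set" where
  "J_inf w p A b i =
     {j. (b $ i) powr p \<ge> 1 - w \<and>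
         A $ i $ j < (((b $ i) powr p + w - 1) / w) powr (1 / p)}"

definition J_set :: "real \<Rightarrow> real \<Rightarrow> real ^ 'n ^ 'm \<Rightarrow> real ^ 'm \<Rightarrow> 'm \<Rightarrow> 'n set" where
  "J_set w p A b i = UNIV - (J_minus w p A b i \<union> J_inf w p A b i)"

definition set_entry :: "real ^ 'n ^ 'm \<Rightarrow> 'm \<Rightarrow> 'n \<Rightarrow> real \<Rightarrow> real ^ 'n ^ 'm" where
  "set_entry A k l v = (\<chi> i j. if i = k \<and> j = l then v else A $ i $ j)"

definition equivalence_operation ::
    "real \<Rightarrow> real \<Rightarrow> real ^ 'n ^ 'm \<Rightarrow> real ^ 'm \<Rightarrow> 'm \<Rightarrow> 'n \<Rightarrow> real \<Rightarrow> bool" where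
  "equivalence_operation w p A b k l v \<longleftrightarrow>
     feasible_set w p (set_entry A k l v) b = feasible_set w p A b"

end

theory Submission
  imports Defs
begin

text \<open>
  A row equation \<open>row_comp w p r x = c\<close> bounds every term of the maximum by \<open>c\<close>; on the scale of
  \<open>p\<close>-th powers, where the weighted power mean is an affine sum, the bound is
  \<open>w * r\<^sub>j powr p + (1 - w) * x\<^sub>j powr p \<le> c powr p\<close>.
  Row \<open>i\<close> therefore limits \<open>(1 - w) * x\<^sub>j\<^sub>0 powr p\<close> to
  \<open>b\<^sub>i powr p - w * a\<^sub>i\<^sub>j\<^sub>0 powr p\<close>, which by hypothesis is strictly less than
  \<open>b\<^sub>k powr p - w * a\<^sub>k\<^sub>j\<^sub>0 powr p\<close>. So at every point satisfying row \<open>i\<close> the term of row \<open>k\<close> at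
  \<open>j\<^sub>0\<close> lies strictly below \<open>b\<^sub>k\<close> (lemma \<open>wpm_less_transfer\<close>), and it still does with
  \<open>a\<^sub>k\<^sub>j\<^sub>0\<close> lowered to \<open>0\<close>. A term strictly below the prescribed maximum does not affect whether
  that maximum is attained (lemma \<open>row_comp_eq_cong\<close>). Since \<open>i \<noteq> k\<close>, row \<open>i\<close> is the same in
  both systems, so the argument applies to the solutions of either one.
\<close>

lemma wpm_powr:
  assumes "0 \<le> w" "w \<le> 1" "p > 0"
  shows "wpm w p x y powr p = w * x powr p + (1 - w) * y powr p"
  using assms by (simp add: wpm_def powr_powr)

lemma wpm_le_iff:
  assumes "0 \<le> w" "w \<le> 1" "p > 0" "0 \<le> c"
  shows "wpm w p x y \<le> c \<longleftrightarrow> w * x powr p + (1 - w) * y powr p \<le> c powr p"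
proof -
  have "0 \<le> wpm w p x y" by (simp add: wpm_def)
  then have "wpm w p x y \<le> c \<longleftrightarrow> wpm w p x y powr p \<le> c powr p"
    using assms powr_mono2[of p "wpm w p x y" c] powr_less_mono2[of p c "wpm w p x y"]
    by linarith
  then show ?thesis using assms by (simp add: wpm_powr)
qed

text \<open>
  Both means share the argument \<open>y\<close>, so on the scale of \<open>p\<close>-th powers its contribution cancels and
  only the slacks left by the first arguments need to be compared.
\<close>
lemma wpm_less_transfer:
  assumes w: "0 \<le> w" "w \<le> 1" and p: "p > 0" and "0 \<le> c" "0 \<le> d"
    and "wpm w p x y \<le> c"
    and "c powr p - w * x powr p < d powr p - w * z powr p"
  shows "wpm w p z y < d"
proof -
  have "wpm w p z y powr p < d powr p"
    using assms wpm_le_iff[OF w p \<open>0 \<le> c\<close>, of x y] by (simp add: wpm_powr)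
  then show ?thesis
    using powr_mono2[of p d "wpm w p z y"] p \<open>0 \<le> d\<close> by linarith
qed

lemma row_comp_eq_iff:
  "row_comp w p r x = c \<longleftrightarrow>
     (\<forall>j. wpm w p (r $ j) (x $ j) \<le> c) \<and> (\<exists>j. wpm w p (r $ j) (x $ j) = c)"
  unfolding row_comp_def by (subst Max_eq_iff) auto

text \<open>
  If the term at \<open>l\<close> stays strictly below \<open>c\<close> then it neither violates the bound \<open>c\<close> nor attains
  it, so the remaining terms alone decide whether the maximum is \<open>c\<close>.
\<close>
lemma row_comp_eq_cong:
  assumes "\<And>j. j \<noteq> l \<Longrightarrow> r $ j = s $ j"
    and "wpm w p (r $ l) (x $ l) < c" "wpm w p (s $ l) (x $ l) < c"
  shows "row_comp w p r x = c \<longleftrightarrow> row_comp w p s x = c"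
  unfolding row_comp_eq_iff using assms by (metis less_imp_le less_irrefl)

theorem lemma5:
  fixes A :: "real ^ 'n ^ 'm" and b :: "real ^ 'm" and w p :: real
    and k :: 'm and j0 :: 'n
  assumes "\<And>i j. A $ i $ j \<in> {0..1}"
    and "\<And>i. b $ i \<in> {0..1}"
    and "0 < w" and "w < 1" and "p > 0"
    and "j0 \<in> J_set w p A b k"
    and "\<exists>i. i \<noteq> k \<and> j0 \<in> J_set w p A b i \<and>
           (b $ i) powr p - (b $ k) powr p < w * ((A $ i $ j0) powr p - (A $ k $ j0) powr p)"
  shows "equivalence_operation w p A b k j0 0"
proof -
  let ?A = "set_entry A k j0 0"
  obtain i where i: "i \<noteq> k"
    and slack: "b $ i powr p - w * (A $ i $ j0) powr p < b $ k powr p - w * (A $ k $ j0) powr p"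
    using assms(7) by (auto simp: right_diff_distrib)
  have w: "0 \<le> w" "w \<le> 1" and b0: "\<And>i. 0 \<le> b $ i"
    using assms by auto
  have same: "?A $ h = A $ h" if "h \<noteq> k" for h
    using that by (simp add: set_entry_def vec_eq_iff)
  have row_k: "row_comp w p (?A $ k) x = b $ k \<longleftrightarrow> row_comp w p (A $ k) x = b $ k"
    if "row_comp w p (A $ i) x = b $ i" for x
  proof (rule row_comp_eq_cong)
    have le: "wpm w p (A $ i $ j0) (x $ j0) \<le> b $ i"
      using that by (simp add: row_comp_eq_iff)
    show "wpm w p (A $ k $ j0) (x $ j0) < b $ k"
      by (rule wpm_less_transfer[OF w assms(5) b0 b0 le slack])
    have "0 \<le> w * (A $ k $ j0) powr p" using w by simp
    then have "b $ i powr p - w * (A $ i $ j0) powr p < b $ k powr p - w * 0 powr p"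
      using slack by simp
    from wpm_less_transfer[OF w assms(5) b0 b0 le this]
    show "wpm w p (?A $ k $ j0) (x $ j0) < b $ k"
      by (simp add: set_entry_def)
  qed (simp add: set_entry_def)
  have "(\<forall>h. row_comp w p (?A $ h) x = b $ h) \<longleftrightarrow> (\<forall>h. row_comp w p (A $ h) x = b $ h)" for x
    using row_k[of x] same i by metis
  then show ?thesis
    by (simp add: equivalence_operation_def feasible_set_def)
qed

end
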